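(* Let $\tau\ge 2$ and $\kappa\ge 1$ be integers and let $x', x, l_2,\dots,l_{\tau-1}, x_1,\dots,x_\kappa \in \{0,1\}$. Then $$x' = 1 \text{ if and only if } \Big(\text{at least one of } x, l_2, \dots, l_{\tau-1} \text{ equals } 1\Big) \text{ or } \Big(x_1 = \cdots = x_\kappa = 1\Big)$$ holds if and only if both inequalities $$((\tau - 1)\kappa + 1)x' - \kappa\Big(x + \sum_{i=2}^{\tau-1} l_i\Big) - \sum_{i=1}^{\kappa} x_i + \kappa - 1 \ge 0$$ and $$-\kappa x' + \kappa\Big(x + \sum_{i=2}^{\tau-1} l_i\Big) + \sum_{i=1}^{\kappa} x_i \ge 0$$ are satisfied. (When $\tau=2$ the sums over $l_i$ are empty.)
   Context: In the paper's modelling of a deduction system, $x$ is a state variable (value $1$ = known, $0$ = unknown), $x'$ is its copy at the next deduction step, and $x$ has path variables $l_1,\dots,l_\tau$, where $l_1$ corresponds to copying $x$ itself, $l_2,\dots,l_{\tau-1}$ to other rules, and $l_\tau$ corresponds to a rule whose premises are the state variables $x_1,\dots,x_\kappa$ (so $l_\tau=1$ iff all $x_i=1$). The copy $x'$ is known exactly when $x$ is known, or some $l_i$ ($2\le i\le\tau-1$) is known, or all of $x_1,\dots,x_\kappa$ are known. *)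

theory Defs
  imports Main
begin

end

theory Submission
  imports Defs
begin

text \<open>
  Put \<open>S = x + (\<Sum>i=2..\<tau> - 1. l i)\<close> and \<open>X = (\<Sum>i=1..\<kappa>. xs i)\<close>, so that \<open>0 \<le> S \<le> \<tau> - 1\<close> and
  \<open>0 \<le> X \<le> \<kappa>\<close>; the deduction condition says \<open>S \<ge> 1\<close> or \<open>X = \<kappa>\<close>.
  For \<open>x' = 1\<close> the first inequality reads \<open>\<kappa> (\<tau> - 1 - S) + (\<kappa> - X) \<ge> 0\<close>, which is automatic, and
  the second \<open>\<kappa> (S - 1) + X \<ge> 0\<close>, which is the condition. For \<open>x' = 0\<close> the second is automatic
  and the first reads \<open>\<kappa> (1 - S) \<ge> X + 1\<close>, which is the negated condition.
\<close>

lemma sum_01_bounds: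
  fixes f :: "'a \<Rightarrow> int"
  assumes "\<And>i. i \<in> A \<Longrightarrow> f i \<in> {0, 1}"
  shows "0 \<le> sum f A" "sum f A \<le> int (card A)"
proof -
  show "0 \<le> sum f A"
    using assms by (force intro: sum_nonneg)
  show "sum f A \<le> int (card A)"
    using sum_bounded_above[of A f 1] assms by force
qed

text \<open>A nonnegative sum over a finite set vanishes only if every term does, and a nonzero 0/1
  term is 1; over the integers, positive means at least 1.\<close>

lemma sum_01_ge_1_iff:
  fixes f :: "'a \<Rightarrow> int"
  assumes "finite A" and "\<And>i. i \<in> A \<Longrightarrow> f i \<in> {0, 1}"
  shows "1 \<le> sum f A \<longleftrightarrow> (\<exists>i\<in>A. f i = 1)"
proof -
  have nonneg: "\<And>i. i \<in> A \<Longrightarrow> 0 \<le> f i"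
    using assms(2) by force
  have "sum f A = 0 \<longleftrightarrow> (\<forall>i\<in>A. f i = 0)"
    using sum_nonneg_eq_0_iff[of A f] assms(1) nonneg by blast
  moreover have "(\<forall>i\<in>A. f i = 0) \<longleftrightarrow> \<not> (\<exists>i\<in>A. f i = 1)"
    using assms(2) by force
  moreover have "0 \<le> sum f A"
    using nonneg by (rule sum_nonneg)
  ultimately show ?thesis by linarith
qed

text \<open>The complements \<open>1 - f i\<close> are nonnegative and sum to \<open>card A\<close>
  minus \<open>sum f A\<close>, so equality forces each of them to be 0.\<close>

lemma sum_01_eq_card_iff:
  fixes f :: "'a \<Rightarrow> int"
  assumes "finite A" and "\<And>i. i \<in> A \<Longrightarrow> f i \<in> {0, 1}"
  shows "sum f A = int (card A) \<longleftrightarrow> (\<forall>i\<in>A. f i = 1)"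
proof -
  have "(\<Sum>i\<in>A. 1 - f i) = 0 \<longleftrightarrow> (\<forall>i\<in>A. 1 - f i = 0)"
    using assms by (intro sum_nonneg_eq_0_iff) force+
  then show ?thesis
    by (auto simp: sum_subtractf)
qed

theorem theorem3:
  fixes \<tau> \<kappa> :: nat
    and x' x :: int
    and l xs :: "nat \<Rightarrow> int"
  assumes "\<tau> \<ge> 2"
    and "\<kappa> \<ge> 1"
    and "x' \<in> {0, 1}"
    and "x \<in> {0, 1}"
    and "\<And>i. i \<in> {2..\<tau> - 1} \<Longrightarrow> l i \<in> {0, 1}"
    and "\<And>i. i \<in> {1..\<kappa>} \<Longrightarrow> xs i \<in> {0, 1}"
  shows "(x' = 1 \<longleftrightarrow>
            (x = 1 \<or> (\<exists>i\<in>{2..\<tau> - 1}. l i = 1)) \<or> (\<forall>i\<in>{1..\<kappa>}. xs i = 1))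
         \<longleftrightarrow>
         ((int \<tau> - 1) * int \<kappa> + 1) * x' - int \<kappa> * (x + (\<Sum>i=2..\<tau> - 1. l i))
             - (\<Sum>i=1..\<kappa>. xs i) + int \<kappa> - 1 \<ge> 0
         \<and> - int \<kappa> * x' + int \<kappa> * (x + (\<Sum>i=2..\<tau> - 1. l i))
             + (\<Sum>i=1..\<kappa>. xs i) \<ge> 0"
proof -
  define S where "S = x + (\<Sum>i=2..\<tau> - 1. l i)"
  define X where "X = (\<Sum>i=1..\<kappa>. xs i)"
  note L = sum_01_bounds[of "{2..\<tau> - 1}" l, OF assms(5)]
  \<comment> \<open>The index set has \<open>\<tau> - 2\<close> elements, none when
    \<open>\<tau> = 2\<close>; \<open>x\<close> contributes one more to the bound.\<close>
  have S0: "0 \<le> S" and S1: "S \<le> int \<tau> - 1"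
    using L assms(1,4) by (auto simp: S_def)
  have X0: "0 \<le> X" and X1: "X \<le> int \<kappa>"
    using sum_01_bounds[of "{1..\<kappa>}" xs, OF assms(6)] by (auto simp: X_def)
  have condS: "(x = 1 \<or> (\<exists>i\<in>{2..\<tau> - 1}. l i = 1)) \<longleftrightarrow> 1 \<le> S"
    using sum_01_ge_1_iff[of "{2..\<tau> - 1}" l, OF finite_atLeastAtMost assms(5)] L(1) assms(4)
    by (auto simp: S_def)
  have condX: "(\<forall>i\<in>{1..\<kappa>}. xs i = 1) \<longleftrightarrow> X = int \<kappa>"
    using sum_01_eq_card_iff[of "{1..\<kappa>}" xs, OF finite_atLeastAtMost assms(6)]
    by (simp add: X_def)
  have "(x' = 1 \<longleftrightarrow> 1 \<le> S \<or> X = int \<kappa>) \<longleftrightarrow>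
      ((int \<tau> - 1) * int \<kappa> + 1) * x' - int \<kappa> * S - X + int \<kappa> - 1 \<ge> 0
      \<and> - int \<kappa> * x' + int \<kappa> * S + X \<ge> 0"
  \<comment> \<open>The product \<open>int \<kappa> * S\<close> is nonlinear. It vanishes for
    \<open>S = 0\<close>; otherwise \<open>lower\<close> and \<open>upper\<close> bound it and
    linear arithmetic suffices.\<close>
  proof (cases "S = 0")
    case True
    have "0 \<le> (int \<tau> - 1) * int \<kappa>"
      using S0 S1 by simp
    then show ?thesis
      using assms(3) True X0 X1 by auto
  next
    case False
    then have S_pos: "1 \<le> S"
      using S0 by simp
    have lower: "int \<kappa> \<le> int \<kappa> * S"
      using mult_left_mono[OF S_pos, of "int \<kappa>"] by simp
    have upper: "int \<kappa> * S \<le> (int \<tau> - 1) * int \<kappa>"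
      using mult_left_mono[OF S1, of "int \<kappa>"] by (simp add: mult.commute)
    from assms(3) consider "x' = 0" | "x' = 1"
      by blast
    then show ?thesis
    proof cases
      case 1
      \<comment> \<open>By \<open>lower\<close> and \<open>X0\<close> the right-hand side is at most
        -1.\<close>
      have "\<not> 0 \<le> - int \<kappa> * S - X + int \<kappa> - 1"
        using lower X0 by linarith
      then show ?thesis
        using 1 S_pos by simp
    next
      case 2
      have "0 \<le> (int \<tau> - 1) * int \<kappa> + 1 - int \<kappa> * S - X + int \<kappa> - 1"
        using upper X1 by linarith
      moreover have "0 \<le> - int \<kappa> + int \<kappa> * S + X"
        using lower X0 by linarith
      ultimately show ?thesis
        using 2 S_pos by simp
    qed
  qed
  then show ?thesis
    unfolding condS condX by (simp only: S_def X_def)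
qed

end
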